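(* Let $F(w)=\mathbb{E}[f(w;\xi)]$, $w\in\mathbb{R}^d$. Assume: (1) $F$ is $\mu$-strongly convex for some $\mu>0$; (2) for every realization of $\xi$, $f(\cdot;\xi)$ is $L$-smooth, with a common constant $L>0$ (the functions $f(\cdot;\xi)$ need not be convex). Let $\kappa=\frac{L}{\mu}$, let $w_*$ be the unique minimizer of $F$ and let $N=2\,\mathbb{E}[\|\nabla f(w_*;\xi)\|^2]$, assumed to satisfy $0<N<\infty$. Let $\alpha=2$ and $E=\frac{2\alpha L\kappa}{\mu}$. Consider the SGD iteration $w_{t+1}=w_t-\eta_t\nabla f(w_t;\xi_t)$, $t\ge0$, started from a given $w_0\in\mathbb{R}^d$, with step sizes $\eta_t=\frac{\alpha}{\mu(t+E)}$ (so that $\eta_t\le\eta_0=\frac{1}{2L\kappa}$). Then $$\mathbb{E}[\|w_t-w_*\|^2]\le\frac{4\alpha^2N}{\mu^2}\,\frac{1}{t-T+E}$$ for every iteration index $$t\ge T=\frac{4L\kappa}{\mu}\max\Big\{\frac{L\kappa\mu}{N}\|w_0-w_*\|^2,\,1\Big\}-\frac{4L\kappa}{\mu}.$$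
   Context: $\xi$ is a random variable with some distribution, and $f(\cdot;\xi):\mathbb{R}^d\to\mathbb{R}$ is differentiable for each realization of $\xi$. The stochastic gradient is unbiased: $\mathbb{E}[\nabla f(w;\xi)]=\nabla F(w)$ for every fixed $w$. The variables $\xi_0,\xi_1,\dots$ are i.i.d. copies of $\xi$. $\|\cdot\|$ is the Euclidean norm. $\mu$-strongly convex: $F(w)-F(w')\ge\langle\nabla F(w'),w-w'\rangle+\frac{\mu}{2}\|w-w'\|^2$ for all $w,w'\in\mathbb{R}^d$. $L$-smooth: $\|\nabla f(w;\xi)-\nabla f(w';\xi)\|\le L\|w-w'\|$ for all $w,w'\in\mathbb{R}^d$. *)

theory Defs
  imports "HOL-Probability.Probability"
begin

text \<open>The gradient is meaningful only where the function is differentiable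
  (see \<open>GDERIV_grad\<close> below); elsewhere \<open>grad h w\<close> is unspecified.\<close>

definition grad :: "('a::real_inner \<Rightarrow> real) \<Rightarrow> 'a \<Rightarrow> 'a" where
  "grad h w = (THE g. GDERIV h w :> g)"

lemma grad_eqI:
  assumes "GDERIV h w :> g"
  shows "grad h w = g"
  unfolding grad_def
proof (rule the_equality)
  fix g' assume "GDERIV h w :> g'"
  with assms have "(\<lambda>v. v \<bullet> g) = (\<lambda>v. v \<bullet> g')"
    unfolding gderiv_def by (rule has_derivative_unique)
  then have "(g - g') \<bullet> g = (g - g') \<bullet> g'"
    by (rule fun_cong)
  then have "(g - g') \<bullet> (g - g') = 0"
    by (simp add: inner_diff_right)
  then show "g' = g"
    by simp
qed (fact assms)

lemma GDERIV_grad: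
  fixes h :: "'a::euclidean_space \<Rightarrow> real"
  assumes "h differentiable (at w)"
  shows "GDERIV h w :> grad h w"
proof -
  from assms obtain D where D: "(h has_derivative D) (at w)"
    by (auto simp: differentiable_def)
  then have lin: "linear D"
    by (rule has_derivative_linear)
  have "D = (\<lambda>v. v \<bullet> adjoint D 1)"
    using adjoint_works[OF lin, of _ 1] by auto
  with D have "GDERIV h w :> adjoint D 1"
    unfolding gderiv_def by simp
  then show ?thesis
    by (simp add: grad_eqI)
qed

definition strongly_convex :: "real \<Rightarrow> ('a::real_inner \<Rightarrow> real) \<Rightarrow> bool" where
  "strongly_convex \<mu> F \<longleftrightarrow>
     (\<forall>w w'. F w - F w' \<ge> grad F w' \<bullet> (w - w') + \<mu> / 2 * (norm (w - w'))\<^sup>2)"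

definition smooth_with :: "real \<Rightarrow> ('a::real_inner \<Rightarrow> real) \<Rightarrow> bool" where
  "smooth_with L h \<longleftrightarrow> (\<forall>w w'. norm (grad h w - grad h w') \<le> L * norm (w - w'))"

text \<open>\<open>sgd f \<eta> \<xi>s w0 t \<omega>\<close> is the iterate after \<open>t\<close> steps along the sample path
  \<open>\<xi>s 0 \<omega>, \<xi>s 1 \<omega>, \<dots>\<close>, started from the deterministic point \<open>w0\<close>.\<close>

primrec sgd ::
  "('a::real_inner \<Rightarrow> 's \<Rightarrow> real) \<Rightarrow> (nat \<Rightarrow> real) \<Rightarrow> (nat \<Rightarrow> 'm \<Rightarrow> 's) \<Rightarrow> 'a \<Rightarrow> nat \<Rightarrow> 'm \<Rightarrow> 'a"
where
  "sgd f \<eta> \<xi>s w0 0 \<omega> = w0"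
| "sgd f \<eta> \<xi>s w0 (Suc t) \<omega> =
     sgd f \<eta> \<xi>s w0 t \<omega> - \<eta> t *\<^sub>R grad (\<lambda>v. f v (\<xi>s t \<omega>)) (sgd f \<eta> \<xi>s w0 t \<omega>)"

end

theory Submission
  imports Defs
begin

text \<open>For a fixed point \<open>w\<close>, unbiasedness, strong monotonicity of the gradient of \<open>F\<close> and
  \<open>\<parallel>\<nabla>f(w;\<xi>)\<parallel>\<^sup>2 \<le> 2\<parallel>\<nabla>f(w;\<xi>) - \<nabla>f(w\<^sub>*;\<xi>)\<parallel>\<^sup>2 + 2\<parallel>\<nabla>f(w\<^sub>*;\<xi>)\<parallel>\<^sup>2\<close> bound the expected squared
  distance to \<open>w\<^sub>*\<close> after one step by \<open>(1 - \<mu>\<eta>)\<parallel>w - w\<^sub>*\<parallel>\<^sup>2 + \<eta>\<^sup>2N\<close>, once \<open>2L\<^sup>2\<eta> \<le> \<mu>\<close>. The iterate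
  \<open>w\<^sub>t\<close> depends only on \<open>\<xi>\<^sub>0, \<dots>, \<xi>\<^sub>t\<^sub>-\<^sub>1\<close>, hence is independent of \<open>\<xi>\<^sub>t\<close>, and Fubini gives the same
  recursion for the mean \<open>Y\<^sub>t\<close> of \<open>\<parallel>w\<^sub>t - w\<^sub>*\<parallel>\<^sup>2\<close>. With \<open>s = t + E\<close> and \<open>b = 4N/\<mu>\<^sup>2\<close> it reads
  \<open>Y\<^sub>t\<^sub>+\<^sub>1 \<le> (1 - 2/s) Y\<^sub>t + b/s\<^sup>2\<close>; multiplying by \<open>s(s - 1)\<close> makes \<open>(s - 1)(s - 2) Y\<^sub>t\<close> grow by at
  most \<open>b\<close> per step, so that \<open>(s - 1)(s - 2) Y\<^sub>t \<le> b(s + T)\<close> by the choice of \<open>T\<close>. Finally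
  \<open>(s + T)(s - T) \<le> s\<^sup>2 \<le> 4(s - 1)(s - 2)\<close> because \<open>s \<ge> E = 4\<kappa>\<^sup>2 \<ge> 4\<close>, where
  \<open>\<kappa> \<ge> 1\<close> since \<open>F\<close> inherits \<open>L\<close>-smoothness.\<close>

section \<open>Minimizers, strong convexity and smoothness\<close>

lemma grad_zero_at_minimizer:
  fixes F :: "'a::euclidean_space \<Rightarrow> real"
  assumes "F differentiable (at w)" and "\<And>v. F w \<le> F v"
  shows "grad F w = 0"
proof -
  have "(F has_derivative (\<lambda>v. v \<bullet> grad F w)) (at w)"
    using GDERIV_grad[OF assms(1)] by (simp add: gderiv_def)
  then have "(\<lambda>v. v \<bullet> grad F w) = (\<lambda>v. 0)"
    by (rule has_derivative_local_min) (simp add: assms(2))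
  then have "grad F w \<bullet> grad F w = 0"
    by (rule fun_cong)
  then show ?thesis by simp
qed

text \<open>Adding the defining inequality to itself with \<open>w\<close> and \<open>w'\<close>
  exchanged cancels the function values, and the two halves of \<open>\<mu>\<close> add up.\<close>

lemma strongly_convex_imp_strongly_monotone:
  assumes "strongly_convex \<mu> F"
  shows "\<mu> * (norm (w - w'))\<^sup>2 \<le> (grad F w - grad F w') \<bullet> (w - w')"
proof -
  have "F w - F w' \<ge> grad F w' \<bullet> (w - w') + \<mu> / 2 * (norm (w - w'))\<^sup>2"
    and "F w' - F w \<ge> grad F w \<bullet> (w' - w) + \<mu> / 2 * (norm (w' - w))\<^sup>2"
    using assms unfolding strongly_convex_def by blast+
  then show ?thesis
    by (simp add: norm_minus_commute[of w' w] inner_diff_left inner_diff_right)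
qed

text \<open>A unit vector, available since the space is nontrivial, tests strong monotonicity
  against Cauchy-Schwarz. This is the source of \<open>E \<ge> 4\<close>.\<close>

lemma strong_convexity_le_lipschitz:
  fixes F :: "'a::euclidean_space \<Rightarrow> real"
  assumes "strongly_convex \<mu> F" and "\<And>w w'. norm (grad F w - grad F w') \<le> L * norm (w - w')"
  shows "\<mu> \<le> L"
proof -
  obtain b :: 'a where b: "norm b = 1"
    using nonempty_Basis norm_Basis by blast
  have "\<mu> \<le> (grad F b - grad F 0) \<bullet> b"
    using strongly_convex_imp_strongly_monotone[OF assms(1), of b 0] b by simp
  also have "\<dots> \<le> norm (grad F b - grad F 0) * norm b"
    by (rule norm_cauchy_schwarz)
  also have "\<dots> \<le> L"
    using assms(2)[of b 0] b by simp
  finally show ?thesis .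
qed

section \<open>Measurability of the stochastic gradient\<close>

text \<open>Each coordinate of the gradient is a pointwise limit of difference quotients along a
  fixed null sequence of nonzero increments, and these quotients involve only two sections of
  \<open>f\<close>.\<close>

lemma borel_measurable_grad:
  fixes f :: "'a::euclidean_space \<Rightarrow> 's \<Rightarrow> real"
  assumes meas: "\<And>v. f v \<in> borel_measurable S"
    and diff: "\<And>x. x \<in> space S \<Longrightarrow> (\<lambda>v. f v x) differentiable (at w)"
  shows "(\<lambda>x. grad (\<lambda>v. f v x) w) \<in> borel_measurable S"
proof (subst borel_measurable_euclidean_space, intro ballI)
  fix b :: 'a assume "b \<in> Basis"
  define h where "h = (\<lambda>n. inverse (real (Suc n)))"
  have h: "filterlim h (at 0) sequentially"
    using LIMSEQ_inverse_real_of_nat by (simp add: h_def filterlim_at del: of_nat_Suc)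
  show "(\<lambda>x. grad (\<lambda>v. f v x) w \<bullet> b) \<in> borel_measurable S"
  proof (rule borel_measurable_LIMSEQ_metric)
    show "(\<lambda>x. (f (w + h n *\<^sub>R b) x - f w x) / h n) \<in> borel_measurable S" for n
      using meas by measurable
    fix x assume "x \<in> space S"
    then have "((\<lambda>v. f v x) has_derivative (\<lambda>v. v \<bullet> grad (\<lambda>v. f v x) w)) (at w)"
      using GDERIV_grad[OF diff] by (simp add: gderiv_def)
    then have "((\<lambda>v. f v x) has_derivative (\<lambda>v. v \<bullet> grad (\<lambda>v. f v x) w)) (at (w + 0 *\<^sub>R b))"
      by simp
    then have "((\<lambda>r. f (w + r *\<^sub>R b) x) has_derivative (\<lambda>r. (r *\<^sub>R b) \<bullet> grad (\<lambda>v. f v x) w)) (at 0)"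
      by (rule has_derivative_compose[rotated]) (auto intro!: derivative_eq_intros)
    then have "((\<lambda>r. f (w + r *\<^sub>R b) x) has_real_derivative (b \<bullet> grad (\<lambda>v. f v x) w)) (at 0)"
      unfolding has_field_derivative_def
      by (rule has_derivative_eq_rhs) (simp add: fun_eq_iff)
    then have "(\<lambda>r. (f (w + r *\<^sub>R b) x - f w x) / r) \<midarrow>0\<rightarrow> b \<bullet> grad (\<lambda>v. f v x) w"
      by (simp add: DERIV_def)
    from filterlim_compose[OF this h]
    show "(\<lambda>n. (f (w + h n *\<^sub>R b) x - f w x) / h n) \<longlonglongrightarrow> grad (\<lambda>v. f v x) w \<bullet> b"
      by (simp add: inner_commute)
  qed
qed

text \<open>Replacing \<open>w\<close> by simple functions of \<open>w\<close> leaves only countably many sections, each of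
  which is measurable.\<close>

lemma borel_measurable_caratheodory:
  fixes g :: "'a::{metric_space, second_countable_topology} \<Rightarrow> 's \<Rightarrow> 'b::metric_space"
  assumes meas: "\<And>w. g w \<in> borel_measurable S"
    and cont: "\<And>x. x \<in> space S \<Longrightarrow> continuous_on UNIV (\<lambda>w. g w x)"
  shows "(\<lambda>(w, x). g w x) \<in> borel_measurable (borel \<Otimes>\<^sub>M S)"
proof -
  \<comment> \<open>The functions \<open>q n\<close> approximate the identity; the base point
    \<open>undefined\<close> is an arbitrary choice.\<close>
  obtain q :: "nat \<Rightarrow> 'a \<Rightarrow> 'a"
    where q: "\<And>n. simple_function borel (q n)" "\<And>w. (\<lambda>n. q n w) \<longlonglongrightarrow> w"
    using borel_measurable_implies_sequence_metric[OF measurable_ident, of undefined]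
    by (auto simp: id_def)
  show ?thesis
  proof (rule borel_measurable_LIMSEQ_metric)
    fix n
    have "countable (range (q n))"
      using simple_functionD(1)[OF q(1)[of n]] by (simp add: countable_finite)
    moreover have "(\<lambda>p. q n (fst p)) \<in> measurable (borel \<Otimes>\<^sub>M S) (count_space (range (q n)))"
    proof -
      have "q n \<in> measurable borel (count_space UNIV)"
        using q(1) by (rule measurable_simple_function)
      then have "q n \<in> measurable borel (count_space (range (q n)))"
        by (auto simp: measurable_def)
      then show ?thesis
        by measurable
    qed
    moreover have "(\<lambda>p. g w (snd p)) \<in> borel_measurable (borel \<Otimes>\<^sub>M S)" for w
      using measurable_snd meas by (rule measurable_compose)
    ultimately show "(\<lambda>p. g (q n (fst p)) (snd p)) \<in> borel_measurable (borel \<Otimes>\<^sub>M S)"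
      by (intro measurable_compose_countable'[where f = "\<lambda>w p. g w (snd p)"
            and g = "\<lambda>p. q n (fst p)" and I = "range (q n)"])
  next
    fix p :: "'a \<times> 's" assume "p \<in> space (borel \<Otimes>\<^sub>M S)"
    then have "isCont (\<lambda>w. g w (snd p)) (fst p)"
      using cont by (auto simp: space_pair_measure continuous_on_eq_continuous_at)
    from isCont_tendsto_compose[OF this q(2)]
    show "(\<lambda>n. g (q n (fst p)) (snd p)) \<longlonglongrightarrow> (case p of (w, x) \<Rightarrow> g w x)"
      by (simp add: case_prod_unfold)
  qed
qed

lemma smooth_with_continuous_grad:
  assumes "smooth_with L h"
  shows "continuous_on UNIV (grad h)"
proof -
  have "norm (grad h w - grad h w') \<le> L * norm (w - w')" for w w'
    using assms by (simp add: smooth_with_def)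
  \<comment> \<open>The sign of \<open>L\<close> is left open here, whereas a Lipschitz constant
    must be nonnegative.\<close>
  also have "L * norm (w - w') \<le> \<bar>L\<bar> * norm (w - w')" for w w'
    by (intro mult_right_mono) auto
  finally have "\<bar>L\<bar>-lipschitz_on UNIV (grad h)"
    by (auto intro!: lipschitz_onI simp: dist_norm)
  then show ?thesis
    by (rule lipschitz_on_continuous_on)
qed

section \<open>The scalar recurrence\<close>

lemma recurrence_product_bound:
  fixes Y :: "nat \<Rightarrow> real"
  assumes "E \<ge> 4" "b \<ge> 0"
    and step: "\<And>i. Y (Suc i) \<le> (1 - 2 / (real i + E)) * Y i + b / (real i + E)\<^sup>2"
  shows "(real t + E - 1) * (real t + E - 2) * Y t \<le> (E - 1) * (E - 2) * Y 0 + b * real t"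
proof (induction t)
  case (Suc t)
  define s where "s = real t + E"
  have s: "s \<ge> 4" using assms(1) by (simp add: s_def)
  have "s * (s - 1) * Y (Suc t) \<le> s * (s - 1) * ((1 - 2 / s) * Y t + b / s\<^sup>2)"
    using step[of t] s by (intro mult_left_mono) (auto simp: s_def)
  also have "\<dots> = (s - 1) * (s - 2) * Y t + b * ((s - 1) / s)"
    using s by (simp add: field_simps power2_eq_square)
  also have "\<dots> \<le> (s - 1) * (s - 2) * Y t + b * 1"
    using s assms(2) by (intro add_left_mono mult_left_mono) auto
  finally show ?case
    using Suc by (simp add: s_def algebra_simps)
qed simp

lemma recurrence_rate:
  fixes Y :: "nat \<Rightarrow> real"
  assumes "E \<ge> 4" "b \<ge> 0" "Y 0 \<ge> 0"
    and step: "\<And>i. Y (Suc i) \<le> (1 - 2 / (real i + E)) * Y i + b / (real i + E)\<^sup>2"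
    and init: "E\<^sup>2 * Y 0 \<le> b * (T + E)" and t: "real t \<ge> T"
  shows "Y t \<le> 4 * b * (1 / (real t - T + E))"
proof -
  define s where "s = real t + E"
  have s: "s \<ge> 4" and sT: "s - T \<ge> 4" using assms(1) t by (auto simp: s_def)
  then have pos: "(s - 1) * (s - 2) > 0" by simp
  have "(s - 1) * (s - 2) * Y t \<le> (E - 1) * (E - 2) * Y 0 + b * real t"
    using recurrence_product_bound[OF assms(1,2) step] by (simp add: s_def)
  also have "(E - 1) * (E - 2) * Y 0 \<le> E\<^sup>2 * Y 0"
    using assms(1,3) by (intro mult_right_mono) (auto simp: power2_eq_square algebra_simps)
  finally have 1: "(s - 1) * (s - 2) * Y t \<le> b * (s + T)"
    using init by (simp add: s_def algebra_simps)
  \<comment> \<open>In this form nonnegativity is visible from \<open>s \<ge> 4\<close> alone,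
    whatever the sign of \<open>T\<close>.\<close>
  have "4 * ((s - 1) * (s - 2)) - (s + T) * (s - T) = 3 * (s * (s - 4)) + T * T + 8"
    by (simp add: algebra_simps)
  also have "\<dots> \<ge> 0"
    using s by simp
  finally have "(s + T) * (s - T) \<le> 4 * ((s - 1) * (s - 2))"
    by simp
  then have "b * ((s + T) * (s - T)) \<le> b * (4 * ((s - 1) * (s - 2)))"
    using assms(2) by (rule mult_left_mono)
  moreover have "(s - 1) * (s - 2) * Y t * (s - T) \<le> b * (s + T) * (s - T)"
    using 1 sT by (intro mult_right_mono) auto
  ultimately have "(s - 1) * (s - 2) * (Y t * (s - T)) \<le> (s - 1) * (s - 2) * (4 * b)"
    by (simp add: mult_ac)
  then have "Y t * (s - T) \<le> 4 * b"
    using pos by (rule mult_left_le_imp_le)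
  then have "Y t \<le> 4 * b / (s - T)"
    using sT by (simp add: pos_le_divide_eq)
  then show ?thesis by (simp add: s_def algebra_simps)
qed

section \<open>One step of stochastic gradient descent in expectation\<close>

text \<open>The two sample spaces may differ, so an iterate on \<open>M\<close> can be rewritten as
  a function of the finite path of samples seen so far.\<close>

lemma sgd_cong:
  assumes "\<And>i. i < t \<Longrightarrow> \<xi>s i \<omega> = \<xi>s' i \<omega>'"
  shows "sgd f \<eta> \<xi>s w0 t \<omega> = sgd f \<eta> \<xi>s' w0 t \<omega>'"
  using assms by (induction t) auto

lemma (in prob_space) gradient_step_bound:
  fixes g :: "'b::euclidean_space \<Rightarrow> 'a \<Rightarrow> 'b"
  assumes int: "integrable M (g w)" and int2: "integrable M (\<lambda>x. (norm (g z x))\<^sup>2)"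
    and lip: "\<And>x. x \<in> space M \<Longrightarrow> norm (g w x - g z x) \<le> L * norm (w - z)"
    and mono: "\<mu> * (norm (w - z))\<^sup>2 \<le> expectation (g w) \<bullet> (w - z)"
    and \<eta>: "0 \<le> \<eta>" "2 * L\<^sup>2 * \<eta> \<le> \<mu>"
  shows "integrable M (\<lambda>x. (norm (w - \<eta> *\<^sub>R g w x - z))\<^sup>2)"
    and "expectation (\<lambda>x. (norm (w - \<eta> *\<^sub>R g w x - z))\<^sup>2)
           \<le> (1 - \<mu> * \<eta>) * (norm (w - z))\<^sup>2 + \<eta>\<^sup>2 * (2 * expectation (\<lambda>x. (norm (g z x))\<^sup>2))"
proof -
  \<comment> \<open>This domination yields a finite second moment at every \<open>w\<close> from the
    one at \<open>z\<close>.\<close>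
  have bound: "(norm (g w x))\<^sup>2 \<le> 2 * L\<^sup>2 * (norm (w - z))\<^sup>2 + 2 * (norm (g z x))\<^sup>2"
    if "x \<in> space M" for x
  proof -
    have "(norm (g w x))\<^sup>2 \<le> (norm (g w x - g z x) + norm (g z x))\<^sup>2"
      using norm_triangle_ineq[of "g w x - g z x" "g z x"] by (intro power_mono) auto
    also have "\<dots> \<le> 2 * (norm (g w x - g z x))\<^sup>2 + 2 * (norm (g z x))\<^sup>2"
      using sum_squares_bound[of "norm (g w x - g z x)" "norm (g z x)"]
      by (simp add: power2_sum)
    also have "(norm (g w x - g z x))\<^sup>2 \<le> (L * norm (w - z))\<^sup>2"
      using lip[OF that] by (intro power_mono) auto
    finally show ?thesis
      by (simp add: power_mult_distrib)
  qed
  have sq: "integrable M (\<lambda>x. (norm (g w x))\<^sup>2)"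
  proof (rule Bochner_Integration.integrable_bound)
    show "integrable M (\<lambda>x. 2 * L\<^sup>2 * (norm (w - z))\<^sup>2 + 2 * (norm (g z x))\<^sup>2)"
      using int2 by simp
    show "(\<lambda>x. (norm (g w x))\<^sup>2) \<in> borel_measurable M"
      using int by measurable
    show "AE x in M. norm ((norm (g w x))\<^sup>2)
            \<le> norm (2 * L\<^sup>2 * (norm (w - z))\<^sup>2 + 2 * (norm (g z x))\<^sup>2)"
      using bound by (intro AE_I2) fastforce
  qed
  have expand: "(norm (w - \<eta> *\<^sub>R g w x - z))\<^sup>2
      = (norm (w - z))\<^sup>2 - 2 * \<eta> * (g w x \<bullet> (w - z)) + \<eta>\<^sup>2 * (norm (g w x))\<^sup>2" for x
  proof -
    have "w - \<eta> *\<^sub>R g w x - z = (w - z) - \<eta> *\<^sub>R g w x"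
      by simp
    then show ?thesis
      by (simp only: power2_norm_eq_inner)
        (simp add: inner_diff_left inner_diff_right inner_commute power2_eq_square algebra_simps)
  qed
  show "integrable M (\<lambda>x. (norm (w - \<eta> *\<^sub>R g w x - z))\<^sup>2)"
    unfolding expand using sq int by simp
  have "expectation (\<lambda>x. (norm (g w x))\<^sup>2)
      \<le> expectation (\<lambda>x. 2 * L\<^sup>2 * (norm (w - z))\<^sup>2 + 2 * (norm (g z x))\<^sup>2)"
    using sq int2 bound by (intro integral_mono) auto
  also have "\<dots> = 2 * L\<^sup>2 * (norm (w - z))\<^sup>2 + 2 * expectation (\<lambda>x. (norm (g z x))\<^sup>2)"
    using int2 by (simp add: prob_space)
  finally have sq_le: "\<eta>\<^sup>2 * expectation (\<lambda>x. (norm (g w x))\<^sup>2)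
      \<le> \<eta>\<^sup>2 * (2 * L\<^sup>2 * (norm (w - z))\<^sup>2 + 2 * expectation (\<lambda>x. (norm (g z x))\<^sup>2))"
    by (intro mult_left_mono) auto
  \<comment> \<open>The cross term contributes a decrease of \<open>2 * \<mu> * \<eta>\<close> times
    the squared distance; half of it absorbs the Lipschitz part of the second moment.\<close>
  have "2 * L\<^sup>2 * \<eta> * (\<eta> * (norm (w - z))\<^sup>2) \<le> \<mu> * (\<eta> * (norm (w - z))\<^sup>2)"
    using \<eta> by (intro mult_right_mono) auto
  moreover have "2 * \<eta> * (\<mu> * (norm (w - z))\<^sup>2) \<le> 2 * \<eta> * (expectation (g w) \<bullet> (w - z))"
    using mono \<eta> by (intro mult_left_mono) auto
  moreover have "expectation (\<lambda>x. (norm (w - \<eta> *\<^sub>R g w x - z))\<^sup>2)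
      = (norm (w - z))\<^sup>2 - 2 * \<eta> * (expectation (g w) \<bullet> (w - z))
        + \<eta>\<^sup>2 * expectation (\<lambda>x. (norm (g w x))\<^sup>2)"
    unfolding expand using sq int by (simp add: prob_space)
  ultimately show "expectation (\<lambda>x. (norm (w - \<eta> *\<^sub>R g w x - z))\<^sup>2)
      \<le> (1 - \<mu> * \<eta>) * (norm (w - z))\<^sup>2 + \<eta>\<^sup>2 * (2 * expectation (\<lambda>x. (norm (g z x))\<^sup>2))"
    using sq_le by (simp add: power2_eq_square algebra_simps)
qed

text \<open>Independence makes the joint law a product, so \<open>X\<close> can be frozen while
  averaging over \<open>Y\<close>. Working with nonnegative integrals first gives integrability
  together with the bound. Both variables share one value type because \<open>indep_var\<close> is a
  family indexed by \<open>bool\<close>.\<close>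

lemma (in prob_space) expectation_indep_le:
  fixes h :: "'b \<times> 'b \<Rightarrow> real"
  assumes indep: "indep_var A X B Y"
    and h[measurable]: "h \<in> borel_measurable (A \<Otimes>\<^sub>M B)" and h_nonneg: "\<And>p. 0 \<le> h p"
    and k[measurable]: "k \<in> borel_measurable A"
    and sec_int: "\<And>x. x \<in> space A \<Longrightarrow> integrable M (\<lambda>\<omega>. h (x, Y \<omega>))"
    and sec_le: "\<And>x. x \<in> space A \<Longrightarrow> expectation (\<lambda>\<omega>. h (x, Y \<omega>)) \<le> k x"
    and kX: "integrable M (\<lambda>\<omega>. k (X \<omega>))"
  shows "integrable M (\<lambda>\<omega>. h (X \<omega>, Y \<omega>))"
    and "expectation (\<lambda>\<omega>. h (X \<omega>, Y \<omega>)) \<le> expectation (\<lambda>\<omega>. k (X \<omega>))"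
proof -
  have X[measurable]: "X \<in> measurable M A" and Y[measurable]: "Y \<in> measurable M B"
    and joint: "distr M A X \<Otimes>\<^sub>M distr M B Y = distr M (A \<Otimes>\<^sub>M B) (\<lambda>\<omega>. (X \<omega>, Y \<omega>))"
    using indep unfolding indep_var_distribution_eq by auto
  interpret DY: prob_space "distr M B Y"
    using Y by (rule prob_space_distr)
  have k_nonneg: "0 \<le> k x" if "x \<in> space A" for x
    using sec_le[OF that] by (rule order_trans[rotated]) (simp add: h_nonneg)
  have XA: "X \<omega> \<in> space A" if "\<omega> \<in> space M" for \<omega>
    using X that by (rule measurable_space)
  have "(\<integral>\<^sup>+\<omega>. ennreal (h (X \<omega>, Y \<omega>)) \<partial>M)
      = (\<integral>\<^sup>+p. ennreal (h p) \<partial>(distr M (A \<Otimes>\<^sub>M B) (\<lambda>\<omega>. (X \<omega>, Y \<omega>))))"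
    by (simp add: nn_integral_distr)
  also have "\<dots> = (\<integral>\<^sup>+x. \<integral>\<^sup>+y. ennreal (h (x, y)) \<partial>distr M B Y \<partial>distr M A X)"
    unfolding joint[symmetric] by (rule DY.nn_integral_fst[symmetric]) simp
  also have "\<dots> \<le> (\<integral>\<^sup>+x. ennreal (k x) \<partial>distr M A X)"
  proof (rule nn_integral_mono)
    fix x assume "x \<in> space (distr M A X)"
    then have x: "x \<in> space A" by simp
    have "(\<lambda>y. ennreal (h (x, y))) \<in> borel_measurable B"
      using x by measurable
    then have "(\<integral>\<^sup>+y. ennreal (h (x, y)) \<partial>distr M B Y) = (\<integral>\<^sup>+\<omega>. ennreal (h (x, Y \<omega>)) \<partial>M)"
      by (simp add: nn_integral_distr)
    also have "\<dots> = ennreal (expectation (\<lambda>\<omega>. h (x, Y \<omega>)))"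
      using sec_int[OF x] by (rule nn_integral_eq_integral) (simp add: h_nonneg)
    also have "\<dots> \<le> ennreal (k x)"
      using sec_le[OF x] by (rule ennreal_leI)
    finally show "(\<integral>\<^sup>+y. ennreal (h (x, y)) \<partial>distr M B Y) \<le> ennreal (k x)" .
  qed
  also have "\<dots> = (\<integral>\<^sup>+\<omega>. ennreal (k (X \<omega>)) \<partial>M)"
    by (simp add: nn_integral_distr)
  also have "\<dots> = ennreal (expectation (\<lambda>\<omega>. k (X \<omega>)))"
    using kX by (rule nn_integral_eq_integral) (auto intro!: AE_I2 k_nonneg XA)
  finally have le: "(\<integral>\<^sup>+\<omega>. ennreal (h (X \<omega>, Y \<omega>)) \<partial>M) \<le> ennreal (expectation (\<lambda>\<omega>. k (X \<omega>)))" .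
  show int: "integrable M (\<lambda>\<omega>. h (X \<omega>, Y \<omega>))"
  proof (rule integrableI_bounded)
    show "(\<lambda>\<omega>. h (X \<omega>, Y \<omega>)) \<in> borel_measurable M"
      by measurable
    show "(\<integral>\<^sup>+\<omega>. ennreal (norm (h (X \<omega>, Y \<omega>))) \<partial>M) < \<infinity>"
      using le by (simp add: h_nonneg le_less_trans)
  qed
  have "0 \<le> expectation (\<lambda>\<omega>. k (X \<omega>))"
    by (intro integral_nonneg_AE AE_I2 k_nonneg XA)
  then show "expectation (\<lambda>\<omega>. h (X \<omega>, Y \<omega>)) \<le> expectation (\<lambda>\<omega>. k (X \<omega>))"
    using le nn_integral_eq_integral[OF int] by (simp add: h_nonneg)
qed

text \<open>The samples are the coordinates of a path \<open>p\<close>. Keeping \<open>J\<close>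
  general lets the induction raise \<open>t\<close> on a fixed product space.\<close>

lemma borel_measurable_sgd:
  fixes f :: "'a::euclidean_space \<Rightarrow> 's \<Rightarrow> real"
  assumes g: "(\<lambda>(w, x). grad (\<lambda>v. f v x) w) \<in> borel_measurable (borel \<Otimes>\<^sub>M S)"
    and "{..<t} \<subseteq> J"
  shows "(\<lambda>p. sgd f \<eta> (\<lambda>i p. p i) w0 t p) \<in> borel_measurable (PiM J (\<lambda>_. S))"
  using assms(2)
proof (induction t)
  case 0
  have "(\<lambda>p. sgd f \<eta> (\<lambda>i p. p i) w0 0 p) = (\<lambda>_. w0)"
    by (simp add: fun_eq_iff)
  then show ?case by simp
next
  case (Suc t)
  then have IH: "(\<lambda>p. sgd f \<eta> (\<lambda>i p. p i) w0 t p) \<in> borel_measurable (PiM J (\<lambda>_. S))"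
    by (simp add: lessThan_Suc)
  have "(\<lambda>p. p t) \<in> measurable (PiM J (\<lambda>_. S)) S"
    using Suc.prems by (intro measurable_component_singleton) auto
  from measurable_compose[OF measurable_Pair[OF IH this] g] IH
  show ?case
    by simp
qed

text \<open>A bound valid for every deterministic starting point \<open>w\<close> of step
  \<open>t\<close> lifts to the random iterate, which is independent of the sample used in that
  step.\<close>

lemma (in prob_space) sgd_step:
  fixes f :: "'b::euclidean_space \<Rightarrow> 's \<Rightarrow> real" and \<xi>s :: "nat \<Rightarrow> 'a \<Rightarrow> 's"
  assumes indep: "indep_vars (\<lambda>_. S) \<xi>s UNIV"
    and g: "(\<lambda>(w, x). grad (\<lambda>v. f v x) w) \<in> borel_measurable (borel \<Otimes>\<^sub>M S)"
    and sec_int: "\<And>w. integrable M (\<lambda>\<omega>. (norm (w - \<eta> t *\<^sub>R grad (\<lambda>v. f v (\<xi>s t \<omega>)) w - z))\<^sup>2)"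
    and sec_le: "\<And>w. expectation (\<lambda>\<omega>. (norm (w - \<eta> t *\<^sub>R grad (\<lambda>v. f v (\<xi>s t \<omega>)) w - z))\<^sup>2)
                   \<le> c * (norm (w - z))\<^sup>2 + b"
    and int: "integrable M (\<lambda>\<omega>. (norm (sgd f \<eta> \<xi>s w0 t \<omega> - z))\<^sup>2)"
  shows "integrable M (\<lambda>\<omega>. (norm (sgd f \<eta> \<xi>s w0 (Suc t) \<omega> - z))\<^sup>2)"
    and "expectation (\<lambda>\<omega>. (norm (sgd f \<eta> \<xi>s w0 (Suc t) \<omega> - z))\<^sup>2)
           \<le> c * expectation (\<lambda>\<omega>. (norm (sgd f \<eta> \<xi>s w0 t \<omega> - z))\<^sup>2) + b"
proof -
  define A where "A = PiM {..<t} (\<lambda>_. S)"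
  define B where "B = PiM {t} (\<lambda>_. S)"
  define X where "X = (\<lambda>\<omega>. \<lambda>i\<in>{..<t}. \<xi>s i \<omega>)"
  \<comment> \<open>The single new sample is packed as a function on \<open>{t}\<close>, so that
    past and present have the same type and are restrictions of one independent family to disjoint
    index sets.\<close>
  define Y where "Y = (\<lambda>\<omega>. \<lambda>i\<in>{t}. \<xi>s i \<omega>)"
  define W where "W = (\<lambda>p. sgd f \<eta> (\<lambda>i p. p i) w0 t p)"
  define h where "h = (\<lambda>(p, q). (norm (W p - \<eta> t *\<^sub>R grad (\<lambda>v. f v (q t)) (W p) - z))\<^sup>2)"
  define k where "k = (\<lambda>p. c * (norm (W p - z))\<^sup>2 + b)"
  have XY: "indep_var A X B Y"
    unfolding A_def B_def X_def Y_def using indep by (rule indep_var_restrict) auto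
  have W[measurable]: "W \<in> borel_measurable A"
    unfolding W_def A_def using g by (rule borel_measurable_sgd) simp
  have Yt: "Y \<omega> t = \<xi>s t \<omega>" for \<omega>
    by (simp add: Y_def)
  have WX: "W (X \<omega>) = sgd f \<eta> \<xi>s w0 t \<omega>" for \<omega>
    unfolding W_def X_def by (rule sgd_cong) simp
  have "(\<lambda>q. q t) \<in> measurable B S"
    unfolding B_def by (rule measurable_component_singleton) simp
  then have "(\<lambda>r. (W (fst r), snd r t)) \<in> measurable (A \<Otimes>\<^sub>M B) (borel \<Otimes>\<^sub>M S)"
    by measurable
  from measurable_compose[OF this g]
  have h: "h \<in> borel_measurable (A \<Otimes>\<^sub>M B)"
    unfolding h_def case_prod_unfold by simp
  have hXY: "h (X \<omega>, Y \<omega>) = (norm (sgd f \<eta> \<xi>s w0 (Suc t) \<omega> - z))\<^sup>2" for \<omega>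
    by (simp add: h_def WX Yt)
  have kX: "k (X \<omega>) = c * (norm (sgd f \<eta> \<xi>s w0 t \<omega> - z))\<^sup>2 + b" for \<omega>
    by (simp add: k_def WX)
  have km: "k \<in> borel_measurable A"
    unfolding k_def by measurable
  have sec: "integrable M (\<lambda>\<omega>. h (p, Y \<omega>))" "expectation (\<lambda>\<omega>. h (p, Y \<omega>)) \<le> k p"
    if "p \<in> space A" for p
    using sec_int[of "W p"] sec_le[of "W p"] by (simp_all add: h_def k_def Yt)
  have ki: "integrable M (\<lambda>\<omega>. k (X \<omega>))"
    unfolding kX using int by simp
  have h0: "0 \<le> h p" for p
    by (simp add: h_def case_prod_unfold)
  show "integrable M (\<lambda>\<omega>. (norm (sgd f \<eta> \<xi>s w0 (Suc t) \<omega> - z))\<^sup>2)"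
    using expectation_indep_le(1)[where h = h and k = k, OF XY h h0 km sec ki] unfolding hXY .
  show "expectation (\<lambda>\<omega>. (norm (sgd f \<eta> \<xi>s w0 (Suc t) \<omega> - z))\<^sup>2)
      \<le> c * expectation (\<lambda>\<omega>. (norm (sgd f \<eta> \<xi>s w0 t \<omega> - z))\<^sup>2) + b"
    using expectation_indep_le(2)[where h = h and k = k, OF XY h h0 km sec ki] int unfolding hXY kX
    by (simp add: prob_space)
qed

section \<open>Convergence rate of the iterates\<close>

theorem theorem4:
  fixes M :: "'m measure" and S :: "'s measure"
    and \<xi> :: "'m \<Rightarrow> 's" and \<xi>s :: "nat \<Rightarrow> 'm \<Rightarrow> 's"
    and f :: "real ^ 'd \<Rightarrow> 's \<Rightarrow> real" and F :: "real ^ 'd \<Rightarrow> real"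
    and w0 ws :: "real ^ 'd"
    and \<mu> L \<kappa> N \<alpha> E T :: real and \<eta> :: "nat \<Rightarrow> real" and t :: nat
  assumes "prob_space M"
    and "\<xi> \<in> measurable M S"
    and "prob_space.indep_vars M (\<lambda>_. S) \<xi>s UNIV"
    and "\<forall>i. distr M S (\<xi>s i) = distr M S \<xi>"
    and "\<forall>w. f w \<in> borel_measurable S"
    and "\<forall>x\<in>space S. \<forall>w. (\<lambda>v. f v x) differentiable (at w)"
    and "\<forall>w. integrable M (\<lambda>\<omega>. f w (\<xi> \<omega>))"
    and "\<forall>w. F w = prob_space.expectation M (\<lambda>\<omega>. f w (\<xi> \<omega>))"
    and "\<forall>w. F differentiable (at w)"
    and "\<forall>w. integrable M (\<lambda>\<omega>. grad (\<lambda>v. f v (\<xi> \<omega>)) w)"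
    and "\<forall>w. prob_space.expectation M (\<lambda>\<omega>. grad (\<lambda>v. f v (\<xi> \<omega>)) w) = grad F w"
    and "\<mu> > 0" and "strongly_convex \<mu> F"
    and "L > 0" and "\<forall>x\<in>space S. smooth_with L (\<lambda>v. f v x)"
    and "\<kappa> = L / \<mu>"
    and "is_arg_min F (\<lambda>_. True) ws"
    and "integrable M (\<lambda>\<omega>. (norm (grad (\<lambda>v. f v (\<xi> \<omega>)) ws))\<^sup>2)"
    and "N = 2 * prob_space.expectation M (\<lambda>\<omega>. (norm (grad (\<lambda>v. f v (\<xi> \<omega>)) ws))\<^sup>2)"
    and "N > 0"
    and "\<alpha> = 2" and "E = 2 * \<alpha> * L * \<kappa> / \<mu>"
    and "\<forall>i. \<eta> i = \<alpha> / (\<mu> * (real i + E))"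
    and "T = 4 * L * \<kappa> / \<mu> * max (L * \<kappa> * \<mu> / N * (norm (w0 - ws))\<^sup>2) 1 - 4 * L * \<kappa> / \<mu>"
    and "real t \<ge> T"
  shows "integrable M (\<lambda>\<omega>. (norm (sgd f \<eta> \<xi>s w0 t \<omega> - ws))\<^sup>2) \<and>
         prob_space.expectation M (\<lambda>\<omega>. (norm (sgd f \<eta> \<xi>s w0 t \<omega> - ws))\<^sup>2)
           \<le> 4 * \<alpha>\<^sup>2 * N / \<mu>\<^sup>2 * (1 / (real t - T + E))"
proof -
  \<comment> \<open>One-step estimates are made under the common law of the samples and then pulled
    back along each \<open>\<xi>s i\<close>.\<close>
  let ?D = "distr M S \<xi>"
  define G where "G = (\<lambda>w x. grad (\<lambda>v. f v x) w)"
  interpret prob_space M by fact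
  interpret D: prob_space ?D
    using assms(2) by (rule prob_space_distr)
  have \<xi>s: "\<xi>s i \<in> measurable M S" for i
    using assms(3) by (auto simp: indep_vars_def)
  have G_meas: "G w \<in> borel_measurable S" for w
    unfolding G_def using assms(5,6) by (intro borel_measurable_grad) auto
  have "(\<lambda>(w, x). G w x) \<in> borel_measurable (borel \<Otimes>\<^sub>M S)"
    using G_meas
  proof (rule borel_measurable_caratheodory)
    fix x assume "x \<in> space S"
    then show "continuous_on UNIV (\<lambda>w. G w x)"
      unfolding G_def using assms(15) smooth_with_continuous_grad by blast
  qed
  then have G_joint: "(\<lambda>(w, x). grad (\<lambda>v. f v x) w) \<in> borel_measurable (borel \<Otimes>\<^sub>M S)"
    by (simp only: G_def)
  have G_int: "integrable ?D (G w)" and G_exp: "D.expectation (G w) = grad F w" for w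
    using assms(10,11) integrable_distr_eq[OF assms(2) G_meas] integral_distr[OF assms(2) G_meas]
    by (simp_all add: G_def)
  have G_lip: "norm (G w x - G w' x) \<le> L * norm (w - w')" if "x \<in> space S" for w w' x
    using assms(15) that by (auto simp: smooth_with_def G_def)
  have sq_meas: "(\<lambda>x. (norm (G ws x))\<^sup>2) \<in> borel_measurable S"
    using G_meas by measurable
  have sq_int: "integrable ?D (\<lambda>x. (norm (G ws x))\<^sup>2)"
    and N: "N = 2 * D.expectation (\<lambda>x. (norm (G ws x))\<^sup>2)"
    using assms(18,19) integrable_distr_eq[OF assms(2) sq_meas] integral_distr[OF assms(2) sq_meas]
    by (simp_all add: G_def)
  have "grad F ws = 0"
    using assms(9,17) by (intro grad_zero_at_minimizer) (auto simp: is_arg_min_linorder)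
  then have mono: "\<mu> * (norm (w - ws))\<^sup>2 \<le> D.expectation (G w) \<bullet> (w - ws)" for w
    using strongly_convex_imp_strongly_monotone[OF assms(13), of w ws] by (simp add: G_exp)
  \<comment> \<open>\<open>F\<close> inherits smoothness because its gradient is an average of
    \<open>L\<close>-Lipschitz maps.\<close>
  have "norm (grad F w - grad F w') \<le> L * norm (w - w')" for w w'
  proof -
    have "norm (grad F w - grad F w') = norm (D.expectation (\<lambda>x. G w x - G w' x))"
      using G_int by (simp flip: G_exp)
    also have "\<dots> \<le> D.expectation (\<lambda>x. norm (G w x - G w' x))"
      by (rule integral_norm_bound)
    also have "\<dots> \<le> D.expectation (\<lambda>x. L * norm (w - w'))"
      using G_int G_lip by (intro integral_mono) auto
    finally show ?thesis
      by (simp add: D.prob_space[simplified])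
  qed
  with assms(13) have "\<mu> \<le> L"
    by (rule strong_convexity_le_lipschitz)
  have E_eq: "E = 4 * (L / \<mu>)\<^sup>2"
    using assms(16,21,22) by (simp add: power2_eq_square)
  have E4: "E \<ge> 4"
    using \<open>\<mu> \<le> L\<close> assms(12) one_le_power[of "L / \<mu>" 2] by (simp add: E_eq)
  have \<eta>: "\<eta> i = 2 / (\<mu> * (real i + E))" for i
    using assms(21,23) by simp
  have \<eta>_nonneg: "0 \<le> \<eta> i" for i
    using E4 assms(12) by (simp add: \<eta>)
  have \<eta>_small: "2 * L\<^sup>2 * \<eta> i \<le> \<mu>" for i
  proof -
    \<comment> \<open>The step sizes decrease in \<open>i\<close>, and \<open>E\<close> is
      calibrated so that equality holds at \<open>i = 0\<close>.\<close>
    have "4 * L\<^sup>2 = \<mu> * (\<mu> * E)"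
      using assms(12) by (simp add: E_eq power_divide power2_eq_square)
    also have "\<dots> \<le> \<mu> * (\<mu> * (real i + E))"
      using assms(12) by (intro mult_left_mono) auto
    finally show ?thesis
      using assms(12) E4 by (simp add: \<eta> pos_divide_le_eq)
  qed
  define c where "c = (\<lambda>i. 1 - \<mu> * \<eta> i)"
  define b where "b = (\<lambda>i. (\<eta> i)\<^sup>2 * N)"
  have section_int: "integrable M (\<lambda>\<omega>. (norm (w - \<eta> i *\<^sub>R grad (\<lambda>v. f v (\<xi>s i \<omega>)) w - ws))\<^sup>2)"
    and section_le: "expectation (\<lambda>\<omega>. (norm (w - \<eta> i *\<^sub>R grad (\<lambda>v. f v (\<xi>s i \<omega>)) w - ws))\<^sup>2)
        \<le> c i * (norm (w - ws))\<^sup>2 + b i" for w i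
  proof -
    have lip: "norm (G w x - G ws x) \<le> L * norm (w - ws)" if "x \<in> space ?D" for x
      using that G_lip by simp
    have D: "?D = distr M S (\<xi>s i)"
      using assms(4) by simp
    have meas: "(\<lambda>x. (norm (w - \<eta> i *\<^sub>R G w x - ws))\<^sup>2) \<in> borel_measurable S"
      using G_meas by measurable
    note step = D.gradient_step_bound[OF G_int sq_int lip mono \<eta>_nonneg \<eta>_small, of i]
    show "integrable M (\<lambda>\<omega>. (norm (w - \<eta> i *\<^sub>R grad (\<lambda>v. f v (\<xi>s i \<omega>)) w - ws))\<^sup>2)"
      using step(1) unfolding D integrable_distr_eq[OF \<xi>s meas] by (simp add: G_def)
    show "expectation (\<lambda>\<omega>. (norm (w - \<eta> i *\<^sub>R grad (\<lambda>v. f v (\<xi>s i \<omega>)) w - ws))\<^sup>2)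
        \<le> c i * (norm (w - ws))\<^sup>2 + b i"
      using step(2) unfolding N[symmetric] unfolding D integral_distr[OF \<xi>s meas]
      by (simp add: G_def c_def b_def)
  qed
  note step = sgd_step[OF assms(3) G_joint section_int section_le]
  have int: "integrable M (\<lambda>\<omega>. (norm (sgd f \<eta> \<xi>s w0 i \<omega> - ws))\<^sup>2)" for i
  proof (induction i)
    case (Suc i)
    then show ?case by (rule step(1))
  qed simp
  define Y where "Y = (\<lambda>i. expectation (\<lambda>\<omega>. (norm (sgd f \<eta> \<xi>s w0 i \<omega> - ws))\<^sup>2))"
  have Y0: "Y 0 = (norm (w0 - ws))\<^sup>2"
    by (simp add: Y_def prob_space)
  \<comment> \<open>The constant agrees with the claimed one since
    \<open>\<alpha>\<^sup>2 = 4\<close>.\<close>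
  have "Y t \<le> 4 * (4 * N / \<mu>\<^sup>2) * (1 / (real t - T + E))"
  proof (rule recurrence_rate)
    show "Y (Suc i) \<le> (1 - 2 / (real i + E)) * Y i + 4 * N / \<mu>\<^sup>2 / (real i + E)\<^sup>2" for i
    proof -
      have "c i = 1 - 2 / (real i + E)" "b i = 4 * N / \<mu>\<^sup>2 / (real i + E)\<^sup>2"
        using assms(12) by (simp_all add: c_def b_def \<eta> power_divide power_mult_distrib)
      then show ?thesis
        using step(2)[OF int, of i] by (simp only: Y_def)
    qed
    \<comment> \<open>With \<open>\<alpha> = 2\<close> the factor
      \<open>4 * L * \<kappa> / \<mu>\<close> in \<open>T\<close> is exactly \<open>E\<close>, so
      adding \<open>E\<close> cancels the subtracted term.\<close>
    have "T + E = E * max (L * \<kappa> * \<mu> / N * Y 0) 1"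
      using assms(21,22,24) by (simp add: Y0)
    also have "\<dots> \<ge> E * (L * \<kappa> * \<mu> / N * Y 0)"
      using E4 by (intro mult_left_mono) auto
    finally have "4 * N / \<mu>\<^sup>2 * (E * (L * \<kappa> * \<mu> / N * Y 0)) \<le> 4 * N / \<mu>\<^sup>2 * (T + E)"
      using assms(20) by (intro mult_left_mono) auto
    \<comment> \<open>Here \<open>L * \<kappa> * \<mu> = L\<^sup>2\<close>, so after cancelling
      \<open>N\<close> the coefficient \<open>4 * L\<^sup>2 / \<mu>\<^sup>2\<close> supplies the
      second factor \<open>E\<close>.\<close>
    moreover have "4 * N / \<mu>\<^sup>2 * (E * (L * \<kappa> * \<mu> / N * Y 0)) = E\<^sup>2 * Y 0"
      using assms(12,20) by (simp add: E_eq assms(16) power2_eq_square field_simps)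
    ultimately show "E\<^sup>2 * Y 0 \<le> 4 * N / \<mu>\<^sup>2 * (T + E)"
      by simp
  qed (use E4 assms(20,25) in \<open>simp_all add: Y0\<close>)
  then show ?thesis
    using int[of t] assms(21) by (simp add: Y_def)
qed

end
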